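(* Let $S=(a_1,a_2,a_3,a_4,\dots)$ be a non-decreasing sequence of positive integers. Then $\chi_S''(P_\infty)=4$ if and only if $a_1=a_2=1$ and $a_3=a_4=2$.
   Context: $P_\infty$ is the (two-way) infinite path: the graph with vertex set $\mathbb{Z}$ in which $i$ and $j$ are adjacent if and only if $|i-j|=1$. For vertices $u,v$ of a graph $G$, $d(u,v)$ is the usual shortest-path distance. For a vertex $u$ and an edge $ab$, $d(u,ab)=d(ab,u)=\min\{d(u,a),d(u,b)\}+1$. For two distinct edges $ab,cd$, $d(ab,cd)=\min\{d(a,c),d(a,d),d(b,c),d(b,d)\}+1$. For a non-decreasing infinite sequence $S=(a_1,a_2,\ldots)$ of positive integers, an $S$-packing total coloring of $G$ using $k$ colors is a map $c:V(G)\cup E(G)\to\{1,\ldots,k\}$ such that any two distinct elements $A,B\in V(G)\cup E(G)$ with $c(A)=c(B)=i$ satisfy $d(A,B)>a_i$. The $S$-packing total chromatic number $\chi_S''(G)$ is the smallest $k$ for which one exists. *)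

theory Defs
  imports Main "HOL-Library.Extended_Nat"
begin

record 'a graph =
  verts :: "'a set"
  edges :: "'a set set"

definition simple_graph :: "'a graph \<Rightarrow> bool" where
  "simple_graph G \<longleftrightarrow> (\<forall>e\<in>edges G. e \<subseteq> verts G \<and> card e = 2)"

definition is_path :: "'a graph \<Rightarrow> 'a \<Rightarrow> 'a list \<Rightarrow> 'a \<Rightarrow> bool" where
  "is_path G u p v \<longleftrightarrow>
     p \<noteq> [] \<and> hd p = u \<and> last p = v \<and> distinct p \<and> set p \<subseteq> verts G \<and>
     (\<forall>i. Suc i < length p \<longrightarrow> {p ! i, p ! Suc i} \<in> edges G)"

text \<open>The distance is \<open>\<infinity>\<close> (the infimum of the empty set) if no path exists.\<close>

definition vdist :: "'a graph \<Rightarrow> 'a \<Rightarrow> 'a \<Rightarrow> enat" where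
  "vdist G u v = (INF p \<in> {p. is_path G u p v}. enat (length p - 1))"

text \<open>A vertex \<open>u\<close> is the element \<open>Inl u\<close> and an edge \<open>e\<close> is the element \<open>Inr e\<close> of the
  disjoint union of vertices and edges. For an edge \<open>e = {a, b}\<close> the infimum over \<open>e\<close> is the
  minimum over the two ends. The values of \<open>elem_dist\<close> are only used on distinct elements.\<close>

definition elements :: "'a graph \<Rightarrow> ('a + 'a set) set" where
  "elements G = verts G <+> edges G"

fun elem_dist :: "'a graph \<Rightarrow> 'a + 'a set \<Rightarrow> 'a + 'a set \<Rightarrow> enat" where
  "elem_dist G (Inl u) (Inl v) = vdist G u v"
| "elem_dist G (Inl u) (Inr e) = (INF a\<in>e. vdist G u a) + 1"
| "elem_dist G (Inr e) (Inl u) = (INF a\<in>e. vdist G u a) + 1"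
| "elem_dist G (Inr e) (Inr f) = (INF a\<in>e. INF b\<in>f. vdist G a b) + 1"

text \<open>Sequences \<open>S = (S 1, S 2, \<dots>)\<close> are indexed from 1; the value \<open>S 0\<close> is irrelevant.\<close>

definition packing_total_coloring ::
    "(nat \<Rightarrow> nat) \<Rightarrow> 'a graph \<Rightarrow> nat \<Rightarrow> ('a + 'a set \<Rightarrow> nat) \<Rightarrow> bool" where
  "packing_total_coloring S G k c \<longleftrightarrow>
     (\<forall>A\<in>elements G. c A \<in> {1..k}) \<and>
     (\<forall>A\<in>elements G. \<forall>B\<in>elements G. A \<noteq> B \<longrightarrow> c A = c B \<longrightarrow> elem_dist G A B > enat (S (c A)))"

text \<open>The value is \<open>\<infinity>\<close> if no number of colors suffices, which can happen on infinite graphs.\<close>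

definition packing_total_chromatic_number :: "(nat \<Rightarrow> nat) \<Rightarrow> 'a graph \<Rightarrow> enat" where
  "packing_total_chromatic_number S G =
     (INF k \<in> {k. \<exists>c. packing_total_coloring S G k c}. enat k)"

definition infinite_path :: "int graph" where
  "infinite_path = \<lparr>verts = UNIV, edges = {{i, j} | i j. \<bar>i - j\<bar> = 1}\<rparr>"

lemma simple_graph_infinite_path: "simple_graph infinite_path"
  unfolding simple_graph_def infinite_path_def by (auto simp: card_insert_if)

end

theory Submission
  imports Defs
begin

text \<open>
  List the elements of the path in their natural order, vertex, edge, vertex, edge, and so on:
  vertex \<open>i\<close> becomes the integer \<open>2 * i\<close> and the edge between \<open>i\<close> and \<open>i + 1\<close> becomes
  \<open>2 * i + 1\<close>. Two elements at positions \<open>p \<noteq> q\<close> have distance \<open>\<lceil>\<bar>p - q\<bar> / 2\<rceil>\<close>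
  (\<open>elem_dist_path_elem\<close>), so a packing total coloring is the same thing as a coloring of the
  integers in which equal colors \<open>i\<close> are more than \<open>2 * S i\<close> apart
  (\<open>ex_packing_total_coloring_iff\<close>).

  In that form the question is one of filling the integers. Any two colors leave a gap in every
  block of three consecutive positions, so with three colors the third one recurs within distance
  3, which forces \<open>S 3 = 1\<close>; conversely the pattern 1 2 3 works if \<open>S 1 = S 2 = S 3 = 1\<close>.
  For a non-decreasing \<open>S\<close>, three colors therefore suffice exactly when \<open>S 3 = 1\<close>
  (\<open>no_three_coloring\<close>, \<open>three_coloring\<close>).

  Let \<open>S 3 \<ge> 2\<close> and suppose that four colors suffice. If \<open>S 2 \<ge> 2\<close>, then 15 consecutive
  positions admit at most 5 + 3 + 3 + 3 = 14 colored ones (\<open>no_four_coloring_if_second_ge_2\<close>), so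
  \<open>S 1 = S 2 = 1\<close>. Density alone does not settle the rest, since 1/3 + 1/3 + 1/5 + 1/7 > 1.
  But positions of color 3 or 4 follow one another in steps of at most 3, while equal ones
  are at least 5 apart. So the two colors alternate, each of them recurs within distance 6, and
  \<open>S 3\<close> and \<open>S 4\<close> are at most 2 (\<open>third_fourth_le_2\<close>). The pattern 1 2 3 1 2 4 attains this.
\<close>

section \<open>Distances in the infinite path\<close>

lemma edge_infinite_path_iff: "{x, y} \<in> edges infinite_path \<longleftrightarrow> \<bar>x - y\<bar> = 1"
  by (auto simp: infinite_path_def doubleton_eq_iff)

text \<open>Every step of a path changes the vertex by 1.\<close>

lemma is_path_infinite_path_length:
  assumes "is_path infinite_path u p v"
  shows "nat \<bar>u - v\<bar> \<le> length p - 1"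
proof -
  have step: "\<bar>p ! i - p ! Suc i\<bar> = 1" if "Suc i < length p" for i
    using assms that by (simp add: is_path_def edge_infinite_path_iff)
  have "\<bar>p ! 0 - p ! i\<bar> \<le> int i" if "i < length p" for i
    using that
  proof (induction i)
    case (Suc i)
    with step[of i] show ?case by auto
  qed simp
  from this[of "length p - 1"] assms show ?thesis
    by (auto simp: is_path_def hd_conv_nth last_conv_nth)
qed

lemma ex_is_path_infinite_path:
  "\<exists>p. is_path infinite_path u p v \<and> length p - 1 = nat \<bar>u - v\<bar>"
proof -
  define p where "p = map (\<lambda>k. u + sgn (v - u) * int k) [0..<Suc (nat \<bar>u - v\<bar>)]"
  have len: "length p = Suc (nat \<bar>u - v\<bar>)" by (simp add: p_def)
  have nth: "p ! k = u + sgn (v - u) * int k" if "k < length p" for k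
    using that unfolding len unfolding p_def by (subst nth_map) (auto simp del: upt_Suc)
  have "p \<noteq> []" using len by auto
  moreover from this have "hd p = u" using nth[of 0] len by (simp add: hd_conv_nth)
  moreover from \<open>p \<noteq> []\<close> have "last p = v"
    using nth[of "nat \<bar>u - v\<bar>"] len by (auto simp: last_conv_nth sgn_if)
  moreover have "distinct p"
    unfolding distinct_conv_nth using nth len by (auto simp: sgn_if)
  moreover have "{p ! k, p ! Suc k} \<in> edges infinite_path" if "Suc k < length p" for k
    using that nth[of k] nth[of "Suc k"] len
    by (auto simp: edge_infinite_path_iff sgn_if)
  ultimately have "is_path infinite_path u p v"
    by (simp add: is_path_def infinite_path_def)
  with len show ?thesis by auto
qed

lemma vdist_infinite_path: "vdist infinite_path u v = enat (nat \<bar>u - v\<bar>)"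
  unfolding vdist_def
proof (rule antisym)
  show "(INF p\<in>{p. is_path infinite_path u p v}. enat (length p - 1)) \<le> enat (nat \<bar>u - v\<bar>)"
    using ex_is_path_infinite_path[of u v] by (metis INF_lower mem_Collect_eq)
  show "enat (nat \<bar>u - v\<bar>) \<le> (INF p\<in>{p. is_path infinite_path u p v}. enat (length p - 1))"
    by (rule INF_greatest) (use is_path_infinite_path_length in auto)
qed

section \<open>Elements of the path as integers\<close>

definition path_elem :: "int \<Rightarrow> int + int set" where
  "path_elem p = (if even p then Inl (p div 2) else Inr {p div 2, p div 2 + 1})"

lemma inj_path_elem: "inj path_elem"
proof (rule injI)
  fix p q assume "path_elem p = path_elem q"
  then show "p = q"
    by (auto simp: path_elem_def doubleton_eq_iff split: if_splits elim!: evenE oddE)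
qed

lemma range_path_elem: "range path_elem = elements infinite_path"
proof (intro equalityI subsetI)
  fix A assume "A \<in> range path_elem"
  then show "A \<in> elements infinite_path"
    by (auto simp: path_elem_def elements_def edge_infinite_path_iff)
       (simp add: infinite_path_def)
next
  fix A assume "A \<in> elements infinite_path"
  then consider u where "A = Inl u" | i j where "A = Inr {i, j}" "\<bar>i - j\<bar> = 1"
    by (auto simp: elements_def infinite_path_def)
  then show "A \<in> range path_elem"
  proof cases
    case 1
    then have "A = path_elem (2 * u)" by (simp add: path_elem_def)
    then show ?thesis by blast
  next
    case 2
    then have "j = i + 1 \<or> i = j + 1" by linarith
    then have "A = path_elem (2 * min i j + 1)"
      using 2 by (auto simp: path_elem_def insert_commute)
    then show ?thesis by blast
  qed
qed

text \<open>On the scale of vertices an edge lies half a step beyond its nearer end. For two edges the half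
  steps add up to the \<open>+ 1\<close> in the distance; for a vertex and an edge the \<open>+ 1\<close> counts half a
  step too many, which is the rounding up.\<close>

lemma elem_dist_path_elem:
  assumes "p \<noteq> q"
  shows "elem_dist infinite_path (path_elem p) (path_elem q) = enat (nat ((\<bar>p - q\<bar> + 1) div 2))"
proof -
  have inf_enat_nat: "inf (enat (nat x)) (enat (nat y)) = enat (nat (min x y))" for x y
    by (cases "x \<le> y") (simp_all add: inf_min min_def)
  have enat_nat_add_one: "enat (nat x) + 1 = enat (nat (x + 1))" if "0 \<le> x" for x
    using that by (simp add: one_enat_def nat_add_distrib)
  define m n where "m = p div 2" and "n = q div 2"
  then consider "p = 2 * m" "q = 2 * n" | "p = 2 * m" "q = 2 * n + 1"
    | "p = 2 * m + 1" "q = 2 * n" | "p = 2 * m + 1" "q = 2 * n + 1"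
    by linarith
  then show ?thesis
  proof cases
    case 1
    then have "(\<bar>p - q\<bar> + 1) div 2 = \<bar>m - n\<bar>" by linarith
    with 1 show ?thesis by (simp add: path_elem_def vdist_infinite_path)
  next
    case 2
    let ?d = "min \<bar>m - n\<bar> \<bar>m - (n + 1)\<bar>"
    from 2 have "(\<bar>p - q\<bar> + 1) div 2 = ?d + 1"
      by linarith
    moreover have "elem_dist infinite_path (path_elem p) (path_elem q) = enat (nat (?d + 1))"
      unfolding 2 by (simp add: path_elem_def vdist_infinite_path inf_enat_nat enat_nat_add_one)
    ultimately show ?thesis by (simp only:)
  next
    case 3
    let ?d = "min \<bar>n - m\<bar> \<bar>n - (m + 1)\<bar>"
    from 3 have "(\<bar>p - q\<bar> + 1) div 2 = ?d + 1"
      by linarith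
    moreover have "elem_dist infinite_path (path_elem p) (path_elem q) = enat (nat (?d + 1))"
      unfolding 3 by (simp add: path_elem_def vdist_infinite_path inf_enat_nat enat_nat_add_one)
    ultimately show ?thesis by (simp only:)
  next
    case 4
    let ?d = "min (min \<bar>m - n\<bar> \<bar>m - (n + 1)\<bar>) (min \<bar>m + 1 - n\<bar> \<bar>m + 1 - (n + 1)\<bar>)"
    from 4 assms have "(\<bar>p - q\<bar> + 1) div 2 = ?d + 1"
      by (cases "m < n") (simp_all add: min_def)
    moreover have "elem_dist infinite_path (path_elem p) (path_elem q) = enat (nat (?d + 1))"
      unfolding 4 by (simp add: path_elem_def vdist_infinite_path inf_enat_nat enat_nat_add_one)
    ultimately show ?thesis by (simp only:)
  qed
qed

section \<open>Packing total colorings as colorings of the integers\<close>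

definition spaced_coloring :: "(nat \<Rightarrow> nat) \<Rightarrow> nat \<Rightarrow> (int \<Rightarrow> nat) \<Rightarrow> bool" where
  "spaced_coloring S k f \<longleftrightarrow>
     (\<forall>p. f p \<in> {1..k}) \<and> (\<forall>p q. p < q \<longrightarrow> f p = f q \<longrightarrow> 2 * int (S (f p)) < q - p)"

lemma spaced_coloring_range: "spaced_coloring S k f \<Longrightarrow> 1 \<le> f p \<and> f p \<le> k"
  by (auto simp: spaced_coloring_def)

lemma spaced_coloringD:
  "spaced_coloring S k f \<Longrightarrow> p < q \<Longrightarrow> f p = f q \<Longrightarrow> 2 * int (S (f p)) < q - p"
  by (auto simp: spaced_coloring_def)

lemma packing_total_coloring_iff_spaced:
  "packing_total_coloring S infinite_path k c \<longleftrightarrow> spaced_coloring S k (c \<circ> path_elem)"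
proof -
  have dist: "enat (S i) < elem_dist infinite_path (path_elem p) (path_elem q)
      \<longleftrightarrow> 2 * int (S i) < \<bar>p - q\<bar>" if "p \<noteq> q" for i p q
    using that by (auto simp: elem_dist_path_elem)
  have "packing_total_coloring S infinite_path k c \<longleftrightarrow>
      (\<forall>p. c (path_elem p) \<in> {1..k}) \<and>
      (\<forall>p q. p \<noteq> q \<longrightarrow> c (path_elem p) = c (path_elem q)
         \<longrightarrow> 2 * int (S (c (path_elem p))) < \<bar>p - q\<bar>)"
    unfolding packing_total_coloring_def range_path_elem[symmetric]
    by (auto simp: dist inj_eq[OF inj_path_elem])
  also have "\<dots> \<longleftrightarrow> spaced_coloring S k (c \<circ> path_elem)"
  proof -
    have "(\<forall>p q. p \<noteq> q \<longrightarrow> f p = f q \<longrightarrow> 2 * int (S (f p)) < \<bar>p - q\<bar>) \<longleftrightarrow>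
        (\<forall>p q. p < q \<longrightarrow> f p = f q \<longrightarrow> 2 * int (S (f p)) < q - p)" for f :: "int \<Rightarrow> nat"
      by (smt (verit))
    from this[of "c \<circ> path_elem"] show ?thesis by (simp add: spaced_coloring_def)
  qed
  finally show ?thesis .
qed

lemma ex_packing_total_coloring_iff:
  "(\<exists>c. packing_total_coloring S infinite_path k c) \<longleftrightarrow> (\<exists>f. spaced_coloring S k f)"
proof
  assume "\<exists>f. spaced_coloring S k f"
  then obtain f where "spaced_coloring S k f" ..
  moreover have "(f \<circ> inv path_elem) \<circ> path_elem = f"
    by (simp add: fun_eq_iff inj_path_elem)
  ultimately show "\<exists>c. packing_total_coloring S infinite_path k c"
    by (metis packing_total_coloring_iff_spaced)
qed (auto simp: packing_total_coloring_iff_spaced)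

lemma spaced_coloring_mono: "spaced_coloring S k f \<Longrightarrow> k \<le> l \<Longrightarrow> spaced_coloring S l f"
  by (simp add: spaced_coloring_def) (meson order_trans)

text \<open>The infimum of a nonempty set of color numbers is attained, and by monotonicity in the
  number of colors it suffices to look at the one number below it.\<close>

lemma packing_total_chromatic_number_eq_Suc_iff:
  "packing_total_chromatic_number S infinite_path = enat (Suc n) \<longleftrightarrow>
     (\<exists>f. spaced_coloring S (Suc n) f) \<and> (\<nexists>f. spaced_coloring S n f)"
    (is "?chi = _ \<longleftrightarrow> ?P (Suc n) \<and> \<not> ?P n")
proof -
  have chi: "?chi = Inf (enat ` {k. ?P k})"
    by (simp add: packing_total_chromatic_number_def ex_packing_total_coloring_iff)
  have le: "?chi \<le> enat k" if "?P k" for k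
    unfolding chi using that by (intro Inf_lower) blast
  show ?thesis
  proof
    assume eq: "?chi = enat (Suc n)"
    then have "{k. ?P k} \<noteq> {}"
      unfolding chi by (metis Inf_empty enat.distinct(1) image_empty top_enat_def)
    then obtain x where "x \<in> enat ` {k. ?P k}" by blast
    then have "Inf (enat ` {k. ?P k}) \<in> enat ` {k. ?P k}"
      unfolding Inf_enat_def by (metis LeastI emptyE)
    with eq chi have "?P (Suc n)" by auto
    moreover have "\<not> ?P n" using le[of n] eq by auto
    ultimately show "?P (Suc n) \<and> \<not> ?P n" ..
  next
    assume P: "?P (Suc n) \<and> \<not> ?P n"
    have "Suc n \<le> k" if "?P k" for k
      using P that spaced_coloring_mono[of S k _ n] by (meson not_less_eq_eq)
    then have "enat (Suc n) \<le> ?chi"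
      unfolding chi by (intro Inf_greatest) (elim imageE CollectE, simp)
    with le[of "Suc n"] P show "?chi = enat (Suc n)" by (simp add: antisym)
  qed
qed

section \<open>Obstructions to colorings\<close>

text \<open>A block of \<open>2 * s + 1\<close> consecutive positions has diameter \<open>2 * s\<close>, so it meets a color
  class with parameter at least \<open>s\<close> at most once.\<close>

lemma card_color_class_le:
  assumes f: "spaced_coloring S k f" and s: "s \<le> S i"
  shows "card {p \<in> {x..<x + (2 * int s + 1) * int m}. f p = i} \<le> m"
proof (induction m)
  case (Suc m)
  define y where "y = x + (2 * int s + 1) * int m"
  have y_next: "x + (2 * int s + 1) * int (Suc m) = y + (2 * int s + 1)"
    by (simp add: y_def algebra_simps)
  have "x \<le> y" by (simp add: y_def)
  let ?B = "{p \<in> {y..<y + (2 * int s + 1)}. f p = i}"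
  have not_less: "\<not> p < q" if "p \<in> ?B" "q \<in> ?B" for p q
  proof
    assume "p < q"
    with that have "2 * int (S i) < q - p" using spaced_coloringD[OF f, of p q] by simp
    with that s show False by simp
  qed
  have "p = q" if "p \<in> ?B" "q \<in> ?B" for p q
    using not_less[OF that] not_less[OF that(2,1)] by simp
  moreover have "finite ?B"
    by (rule finite_subset[OF _ finite_atLeastLessThan_int[of y "y + (2 * int s + 1)"]]) blast
  ultimately have B: "card ?B \<le> 1"
    unfolding One_nat_def by (subst card_le_Suc0_iff_eq) blast+
  have "{p \<in> {x..<y + (2 * int s + 1)}. f p = i} = {p \<in> {x..<y}. f p = i} \<union> ?B"
    (is "?U = ?A \<union> ?B")
    using \<open>x \<le> y\<close> by auto
  then have "card ?U \<le> card ?A + card ?B"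
    by (simp only: card_Un_le)
  also have "\<dots> \<le> Suc m"
    using B Suc.IH[folded y_def] by linarith
  finally show ?case unfolding y_next .
qed simp

text \<open>The length 15 is a common multiple of the block lengths 3 and 5 that belong to the parameters
  1 and 2, so the bounds for the single colors are exact and add up to 14.\<close>

lemma no_four_coloring_if_second_ge_2:
  assumes f: "spaced_coloring S 4 f"
    and S: "1 \<le> S 1" "2 \<le> S 2" "2 \<le> S 3" "2 \<le> S 4"
  shows False
proof -
  let ?C = "\<lambda>i. {p \<in> {0..<15}. f p = i}"
  have "{0..<15} = (\<Union>i\<in>{1..4}. ?C i)"
    using spaced_coloring_range[OF f] by fastforce
  then have "card {0..<15::int} = card (\<Union>i\<in>{1..4}. ?C i)"
    by (rule arg_cong)
  also have "\<dots> \<le> (\<Sum>i\<in>{1..4}. card (?C i))"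
    by (rule card_UN_le) (rule finite_atLeastAtMost)
  also have "{1..4::nat} = {1, 2, 3, 4}"
    by auto
  also have "(\<Sum>i\<in>{1, 2, 3, 4}. card (?C i)) = card (?C 1) + card (?C 2) + card (?C 3) + card (?C 4)"
    by simp
  also have "\<dots> \<le> 5 + 3 + 3 + 3"
    using card_color_class_le[OF f S(1), of 0 5] card_color_class_le[OF f S(2), of 0 3]
      card_color_class_le[OF f S(3), of 0 3] card_color_class_le[OF f S(4), of 0 3]
    by (intro add_mono) simp_all
  finally show False by simp
qed

text \<open>Three consecutive positions have three different colors, so they are not all colored with
  1 and 2.\<close>

lemma ex_next_color_gt_2:
  assumes f: "spaced_coloring S k f" and S: "\<And>i. 1 \<le> i \<Longrightarrow> 1 \<le> S i"
  shows "\<exists>q. p < q \<and> q \<le> p + 3 \<and> 2 < f q"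
proof (rule ccontr)
  assume "\<not> ?thesis"
  then have le: "f q \<le> 2" if "p < q" "q \<le> p + 3" for q using that by (meson not_le)
  have ge: "1 \<le> f q" for q using spaced_coloring_range[OF f] by blast
  have "f q \<noteq> f r" if "q < r" "r - q \<le> 2" for q r
    using spaced_coloringD[OF f that(1)] S[OF ge[of q]] that(2) by fastforce
  from this[of "p + 1" "p + 2"] this[of "p + 1" "p + 3"] this[of "p + 2" "p + 3"]
  show False
    using le[of "p + 1"] le[of "p + 2"] le[of "p + 3"] ge[of "p + 1"] ge[of "p + 2"] ge[of "p + 3"]
    by simp
qed

lemma no_three_coloring:
  assumes f: "spaced_coloring S 3 f" and S: "\<And>i. 1 \<le> i \<Longrightarrow> 1 \<le> S i" "2 \<le> S 3"
  shows False
proof -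
  obtain p where p: "2 < f p"
    using ex_next_color_gt_2[OF f S(1)] by blast
  obtain q where q: "p < q" "q \<le> p + 3" "2 < f q"
    using ex_next_color_gt_2[OF f S(1)] by blast
  have "f p = 3" "f q = 3"
    using p q spaced_coloring_range[OF f, of p] spaced_coloring_range[OF f, of q] by auto
  with spaced_coloringD[OF f q(1)] q(2) S(2) show False by simp
qed

text \<open>Consecutive positions with colors 3 and 4 are at most 3 apart, which is too close for equal
  colors. Hence the two colors alternate along these positions, and two steps, of total
  length at most 6, lead back to the same color.\<close>

lemma third_fourth_le_2:
  assumes f: "spaced_coloring S 4 f" and S: "\<And>i. 1 \<le> i \<Longrightarrow> 1 \<le> S i" "2 \<le> S 3" "2 \<le> S 4"
  shows "S 3 \<le> 2 \<and> S 4 \<le> 2"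
proof -
  note step = ex_next_color_gt_2[OF f S(1)]
  obtain q0 where q0: "2 < f q0" using step by blast
  obtain q1 where q1: "q0 < q1" "q1 \<le> q0 + 3" "2 < f q1" using step by blast
  obtain q2 where q2: "q1 < q2" "q2 \<le> q1 + 3" "2 < f q2" using step by blast
  obtain q3 where q3: "q2 < q3" "q3 \<le> q2 + 3" "2 < f q3" using step by blast
  have color: "f q = 3 \<or> f q = 4" if "2 < f q" for q
    using that spaced_coloring_range[OF f, of q] by auto
  have alternate: "f q \<noteq> f r" if "2 < f q" "q < r" "r \<le> q + 3" for q r
    using spaced_coloringD[OF f that(2)] color[OF that(1)] S(2,3) that(3) by fastforce
  have neq: "f q0 \<noteq> f q1" "f q1 \<noteq> f q2" "f q2 \<noteq> f q3"
    using alternate q0 q1 q2 q3 by blast+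
  then have "f q0 = f q2" "f q1 = f q3"
    using color[OF q0] color[OF q1(3)] color[OF q2(3)] color[OF q3(3)] by auto
  then have "S (f q0) \<le> 2" "S (f q1) \<le> 2"
    using spaced_coloringD[OF f, of q0 q2] spaced_coloringD[OF f, of q1 q3] q1 q2 q3 by auto
  with neq(1) color[OF q0] color[OF q1(3)] show ?thesis by auto
qed

section \<open>Periodic colorings\<close>

lemma three_coloring:
  assumes "S 1 = 1" "S 2 = 1" "S 3 = 1"
  shows "\<exists>f. spaced_coloring S 3 f"
proof
  define f :: "int \<Rightarrow> nat" where
    "f p = (if p mod 3 = 0 then 1 else if p mod 3 = 1 then 2 else 3)" for p
  have "2 * int (S (f p)) < q - p" if "p < q" "f p = f q" for p q
  proof -
    have "p mod 3 = q mod 3"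
    proof -
      have "r mod 3 = 2" if "r mod 3 \<noteq> 0" "r mod 3 \<noteq> 1" for r :: int
        using that by presburger
      with \<open>f p = f q\<close> show ?thesis
        by (simp add: f_def split: if_splits)
    qed
    with \<open>p < q\<close> have "2 < q - p" by presburger
    moreover have "S (f p) = 1" using assms by (simp add: f_def)
    ultimately show ?thesis by simp
  qed
  then show "spaced_coloring S 3 f"
    by (simp add: spaced_coloring_def f_def)
qed

lemma four_coloring:
  assumes "S 1 = 1" "S 2 = 1" "S 3 = 2" "S 4 = 2"
  shows "\<exists>f. spaced_coloring S 4 f"
proof
  define f :: "int \<Rightarrow> nat" where
    "f p = (if p mod 3 = 0 then 1 else if p mod 3 = 1 then 2 else if p mod 6 = 2 then 3 else 4)"
    for p
  \<comment> \<open>The pattern 1 2 3 1 2 4: each color class is a single residue class, modulo 3 for the colors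
    1 and 2 and modulo 6 for the colors 3 and 4.\<close>
  have class1: "r mod 3 = 0" if "f r = 1" for r
    using that by (simp add: f_def split: if_splits)
  have class2: "r mod 3 = 1" if "f r = 2" for r
    using that by (simp add: f_def split: if_splits)
  have class3: "r mod 6 = 2" if "f r = 3" for r
    using that by (simp add: f_def split: if_splits)
  have class4: "r mod 6 = 5" if "f r = 4" for r
  proof -
    have "r mod 3 \<noteq> 0" "r mod 3 \<noteq> 1" "r mod 6 \<noteq> 2"
      using that by (simp_all add: f_def split: if_splits)
    then show ?thesis by presburger
  qed
  have "2 * int (S (f p)) < q - p" if "p < q" "f p = f q" for p q
  proof -
    consider "f p = 1" | "f p = 2" | "f p = 3" | "f p = 4"
      unfolding f_def by metis
    then show ?thesis
    proof cases
      case 1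
      then have "p mod 3 = q mod 3"
        using that(2) class1[of p] class1[of q] by simp
      with \<open>p < q\<close> have "2 < q - p" by presburger
      with 1 assms show ?thesis by simp
    next
      case 2
      then have "p mod 3 = q mod 3"
        using that(2) class2[of p] class2[of q] by simp
      with \<open>p < q\<close> have "2 < q - p" by presburger
      with 2 assms show ?thesis by simp
    next
      case 3
      then have "p mod 6 = q mod 6"
        using that(2) class3[of p] class3[of q] by simp
      with \<open>p < q\<close> have "4 < q - p" by presburger
      with 3 assms show ?thesis by simp
    next
      case 4
      then have "p mod 6 = q mod 6"
        using that(2) class4[of p] class4[of q] by simp
      with \<open>p < q\<close> have "4 < q - p" by presburger
      with 4 assms show ?thesis by simp
    qed
  qed
  then show "spaced_coloring S 4 f"
    by (simp add: spaced_coloring_def f_def)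
qed

section \<open>The sequences with packing total chromatic number 4\<close>

theorem theorem10:
  fixes a :: "nat \<Rightarrow> nat"
  assumes "mono_on {1..} a"
    and "\<And>i. i \<ge> 1 \<Longrightarrow> a i > 0"
  shows "packing_total_chromatic_number a infinite_path = 4 \<longleftrightarrow>
           a 1 = 1 \<and> a 2 = 1 \<and> a 3 = 2 \<and> a 4 = 2"
proof -
  have pos: "1 \<le> a i" if "1 \<le> i" for i
    using assms(2)[OF that] by simp
  have mono: "a i \<le> a j" if "1 \<le> i" "i \<le> j" for i j
    using assms(1) that by (auto simp: mono_on_def)
  have "packing_total_chromatic_number a infinite_path = 4 \<longleftrightarrow>
      (\<exists>f. spaced_coloring a 4 f) \<and> (\<nexists>f. spaced_coloring a 3 f)"
    using packing_total_chromatic_number_eq_Suc_iff[of a 3] by (simp add: numeral_eq_enat)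
  also have "\<dots> \<longleftrightarrow> a 1 = 1 \<and> a 2 = 1 \<and> a 3 = 2 \<and> a 4 = 2"
  proof
    assume *: "(\<exists>f. spaced_coloring a 4 f) \<and> (\<nexists>f. spaced_coloring a 3 f)"
    then obtain f where f: "spaced_coloring a 4 f" by blast
    have le: "1 \<le> a 1" "a 1 \<le> a 2" "a 2 \<le> a 3" "a 3 \<le> a 4"
      using pos mono by simp_all
    have "\<not> (a 1 = 1 \<and> a 2 = 1 \<and> a 3 = 1)"
      using * three_coloring by blast
    with le have a34: "2 \<le> a 3" "2 \<le> a 4" by linarith+
    have "a 2 < 2"
      using no_four_coloring_if_second_ge_2[OF f] le(1) a34 by (meson not_le)
    with third_fourth_le_2[OF f pos a34] a34 le
    show "a 1 = 1 \<and> a 2 = 1 \<and> a 3 = 2 \<and> a 4 = 2" by linarith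
  next
    assume "a 1 = 1 \<and> a 2 = 1 \<and> a 3 = 2 \<and> a 4 = 2"
    then show "(\<exists>f. spaced_coloring a 4 f) \<and> (\<nexists>f. spaced_coloring a 3 f)"
      using four_coloring[of a] no_three_coloring[of a, OF _ pos] by auto
  qed
  finally show ?thesis .
qed

end
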